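(* Let $n\in\mathbb{N}$ with $n\ge 2$, and suppose that $\alpha_n = 2^n+1$, $\beta_n = 2^{n+1}+3$ and $\gamma_n = 2^n+3$ are all prime. Put $\lambda_n = 2^n\alpha_n\beta_n$ and $\mu_n = 2^n(\alpha_n+\beta_n)+2^n\alpha_n\beta_n$. Then $\sigma(\lambda_n)=\mu_n$ if and only if $n=2$.
   Context: $\mathbb{N}=\{1,2,\dots\}$. For $k\in\mathbb{N}$, $\sigma(k)$ denotes the sum of the proper divisors (aliquot parts) of $k$, i.e. $\sigma(k)=\sum_{d\mid k,\ d<k} d$, the sum being over positive divisors $d$ of $k$ with $d<k$ (note that $k$ itself is excluded). *)

theory Defs
  imports Main "HOL-Computational_Algebra.Primes"
begin

(* d dvd k and d < k force k > 0 and hence d > 0, so only positive divisors are summed. *)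
definition aliquot_sum :: "nat \<Rightarrow> nat" where
  "aliquot_sum k = (\<Sum>d | d dvd k \<and> d < k. d)"

definition alpha :: "nat \<Rightarrow> nat" where
  "alpha n = 2 ^ n + 1"

definition beta :: "nat \<Rightarrow> nat" where
  "beta n = 2 ^ (n + 1) + 3"

definition gamma :: "nat \<Rightarrow> nat" where
  "gamma n = 2 ^ n + 3"

definition lam :: "nat \<Rightarrow> nat" where
  "lam n = 2 ^ n * alpha n * beta n"

definition mu :: "nat \<Rightarrow> nat" where
  "mu n = 2 ^ n * (alpha n + beta n) + 2 ^ n * alpha n * beta n"

end

theory Submission
  imports Defs
begin

text \<open>By multiplicativity of the sum of all divisors, with \<open>x = 2 ^ n\<close> the equation becomes
  \<open>2 (2 x - 1) (x + 2)\<^sup>2 = x (3 x + 4) + 2 x (x + 1) (2 x + 3)\<close>, that is \<open>(x - 4) (x + 2) = 0\<close>.\<close>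

lemma aliquot_sum_add_self:
  assumes "k > 0"
  shows "aliquot_sum k + k = \<Sum>{d. d dvd k}"
proof -
  have "{d. d dvd k} = insert k {d. d dvd k \<and> d < k}"
    using assms by (auto dest: dvd_imp_le)
  then show ?thesis
    by (simp add: aliquot_sum_def)
qed

text \<open>The divisors of \<open>m * p\<close> are those of \<open>m\<close> together with their
  multiples by \<open>p\<close>. The second family contributes \<open>p\<close> times the sum of the
  first.\<close>

lemma sum_divisors_mult_prime:
  fixes m p :: nat
  assumes "prime p" and "\<not> p dvd m"
  shows "\<Sum>{d. d dvd m * p} = (p + 1) * \<Sum>{d. d dvd m}"
proof -
  have "m > 0"
    using assms(2) by (cases m) auto
  then have fin: "finite {d. d dvd m}"
    by simp
  have p0: "p > 0"
    using assms(1) by (rule prime_gt_0_nat)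
  have split: "{d. d dvd m * p} = {d. d dvd m} \<union> (\<lambda>d. d * p) ` {d. d dvd m}"
  proof (intro equalityI subsetI)
    fix d
    assume "d \<in> {d. d dvd m * p}"
    then obtain a b where "d = a * b" "a dvd m" "b dvd p"
      using division_decomp[of d m p] by auto
    moreover from this have "b = 1 \<or> b = p"
      using assms(1) by (simp add: prime_nat_iff)
    ultimately show "d \<in> {d. d dvd m} \<union> (\<lambda>d. d * p) ` {d. d dvd m}"
      by auto
  qed auto
  \<comment> \<open>A common element \<open>d * p\<close> would divide \<open>m\<close>, and then so
    would \<open>p\<close>.\<close>
  have disj: "{d. d dvd m} \<inter> (\<lambda>d. d * p) ` {d. d dvd m} = {}"
    using assms(2) by (auto dest: dvd_mult_right)
  have inj: "inj_on (\<lambda>d. d * p) {d. d dvd m}"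
    using p0 by (auto simp: inj_on_def)
  have "\<Sum>{d. d dvd m * p} = \<Sum>{d. d dvd m} + (\<Sum>d | d dvd m. d * p)"
    unfolding split using fin disj inj
    by (simp add: sum.union_disjoint sum.reindex)
  then show ?thesis
    by (simp add: sum_distrib_right[symmetric] algebra_simps)
qed

text \<open>A geometric sum over the exponents \<open>0\<close> to \<open>n\<close>. The
  \<open>+ 1\<close> on the left avoids truncated subtraction on \<open>nat\<close>.\<close>

lemma sum_divisors_two_power: "\<Sum>{d::nat. d dvd 2 ^ n} + 1 = 2 ^ (n + 1)"
proof -
  have "{d::nat. d dvd 2 ^ n} = (^) 2 ` {..n}"
    by (auto simp: divides_primepow_nat)
  moreover have "inj_on ((^) (2::nat)) {..n}"
    by (simp add: inj_on_def)
  ultimately have "\<Sum>{d::nat. d dvd 2 ^ n} = (\<Sum>i\<le>n. 2 ^ i)"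
    by (simp add: sum.reindex)
  also have "\<dots> + 1 = 2 ^ (n + 1)"
    by (induction n) auto
  finally show ?thesis .
qed

text \<open>The primes \<open>beta n\<close> and \<open>alpha n\<close> are split off in turn. Both
  are odd, so neither divides \<open>2 ^ n\<close>; for \<open>alpha n\<close> this uses
  \<open>n > 0\<close>, since \<open>alpha 0 = 2\<close>.\<close>

lemma sum_divisors_lam:
  assumes "n > 0" and "prime (alpha n)" and "prime (beta n)"
  shows "\<Sum>{d. d dvd lam n} = (beta n + 1) * ((alpha n + 1) * \<Sum>{d. d dvd 2 ^ n})"
proof -
  have odd: "odd (alpha n)" "odd (beta n)"
    using assms(1) by (simp_all add: alpha_def beta_def)
  have not_dvd_power: "\<not> p dvd 2 ^ n" if "prime p" "odd p" for p :: nat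
  proof
    assume "p dvd 2 ^ n"
    then have "p = 2"
      using that(1) prime_dvd_power primes_dvd_imp_eq two_is_prime_nat by blast
    then show False
      using that(2) by simp
  qed
  \<comment> \<open>Size suffices here: \<open>0 < alpha n < beta n\<close>.\<close>
  have "\<not> beta n dvd alpha n"
    using dvd_imp_le[of "beta n" "alpha n"] by (auto simp: alpha_def beta_def)
  then have "\<not> beta n dvd 2 ^ n * alpha n"
    using assms(3) odd(2) not_dvd_power by (simp add: prime_dvd_mult_iff)
  then show ?thesis
    unfolding lam_def
    using sum_divisors_mult_prime assms(2,3) odd(1) not_dvd_power by simp
qed

theorem mainTheorem3:
  fixes n :: nat
  assumes "n \<ge> 2"
    and "prime (alpha n)"
    and "prime (beta n)"
    and "prime (gamma n)"
  shows "aliquot_sum (lam n) = mu n \<longleftrightarrow> n = 2"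
proof -
  \<comment> \<open>Working over \<open>int\<close> makes \<open>2 * x - 1\<close> and the
    difference of the two sides genuine subtractions.\<close>
  define x :: int where "x = 2 ^ n"
  have x: "x > 0"
    by (simp add: x_def)
  define S :: nat where "S = \<Sum>{d. d dvd 2 ^ n}"
  have "S + 1 = 2 ^ (n + 1)"
    unfolding S_def by (rule sum_divisors_two_power)
  then have "int (S + 1) = int (2 ^ (n + 1))"
    by (rule arg_cong)
  then have S: "int S = 2 * x - 1"
    by (simp add: x_def)
  have alpha: "int (alpha n) = x + 1" and beta: "int (beta n) = 2 * x + 3"
    by (simp_all add: alpha_def beta_def x_def)
  have lam: "int (lam n) = x * (x + 1) * (2 * x + 3)"
    by (simp add: lam_def alpha beta x_def)
  have mu: "int (mu n) = x * (3 * x + 4) + x * (x + 1) * (2 * x + 3)"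
    by (simp add: mu_def alpha beta x_def algebra_simps)
  have "lam n > 0"
    by (simp add: lam_def alpha_def beta_def)
  then have "aliquot_sum (lam n) + lam n = \<Sum>{d. d dvd lam n}"
    by (rule aliquot_sum_add_self)
  also have "\<dots> = (beta n + 1) * ((alpha n + 1) * S)"
    unfolding S_def using assms(1-3) by (intro sum_divisors_lam) auto
  finally have "int (aliquot_sum (lam n) + lam n) = int ((beta n + 1) * ((alpha n + 1) * S))"
    by (rule arg_cong)
  then have "int (aliquot_sum (lam n)) + x * (x + 1) * (2 * x + 3) =
      (2 * x + 3 + 1) * ((x + 1 + 1) * (2 * x - 1))"
    by (simp only: of_nat_add of_nat_mult of_nat_1 alpha beta lam S)
  \<comment> \<open>After substituting for \<open>mu n\<close>, the cubic terms cancel and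
    \<open>x^2 - 2 * x - 8\<close> remains.\<close>
  then have "int (aliquot_sum (lam n)) - int (mu n) = (x - 4) * (x + 2)"
    unfolding mu by algebra
  then have "aliquot_sum (lam n) = mu n \<longleftrightarrow> (x - 4) * (x + 2) = 0"
    by linarith
  \<comment> \<open>Positivity of \<open>x\<close> rules out the root \<open>-2\<close>. The root
    \<open>4\<close> is written as a power of \<open>2\<close> so that exponents can be compared
    next.\<close>
  also have "\<dots> \<longleftrightarrow> x = 2 ^ 2"
    using x by simp
  also have "\<dots> \<longleftrightarrow> n = 2"
    unfolding x_def by (rule power_inject_exp) simp
  finally show ?thesis .
qed

end
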